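(* Let $k\ge 1$. An $X_k$ subtree of $T_B(\infty)$ is composed of a chain of $k+1$ nodes (its rightmost chain, starting at its root, where the root is followed by its left son and each subsequent node by its right son), whose successive edges are labeled $1,2,\dots,k$, and whose $i$-th node is the root of an $X_{i-1}$ subtree for all $i$ between $1$ and $k+1$. That is, the node set of the $X_k$ subtree is the disjoint union of the node sets of these $X_{i-1}$ subtrees ($1\le i\le k+1$), and its edges are exactly the edges of these subtrees together with the $k$ edges of the chain.
   Context: A partition is a finite sequence of integers $a=(a_1,\dots,a_k)$ with $a_1\ge\dots\ge a_k>0$ (the empty partition $()$ is allowed); by convention $a_j=0$ for $j>k$. $a^{\downarrow_i}$ denotes the sequence obtained from $a$ by replacing $a_i$ by $a_i+1$. $T_B(\infty)$ is the edge-labeled rooted binary tree with root $()$ in which every node $a$ has a left son $a^{\downarrow_1}$ (edge labeled $1$), and in which a nonempty node $a$ has in addition a right son exactly when, with $p\ge 1$ denoting the number of parts of $a$ equal to $a_1$, one has $a_p-a_{p+1}=1$; the right son is then $a^{\downarrow_{p+1}}$ (edge labeled $p+1$). Its nodes are the partitions generated from the root in this way. For $k\ge 1$, an $X_k$ subtree is a subtree of $T_B(\infty)$ rooted at a node $a=(i,\dots,i,a_{k+1},\dots)$ whose first $k$ parts equal $i$ and with $a_{k+1}\le i-1$, and which is: the whole subtree of $T_B(\infty)$ rooted at $a$ if $a$ has only one son; and otherwise $a$ together with its left subtree (the whole subtree rooted at its left son, and the edge to it). An $X_0$ subtree is a single node. *)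

theory Defs
  imports "Graph_Theory.Digraph_Component"
begin

definition is_partition :: "nat list \<Rightarrow> bool" where
  "is_partition a \<longleftrightarrow> sorted_wrt (\<ge>) a \<and> (\<forall>x\<in>set a. 0 < x)"

text \<open>Parts are numbered from 1, and the parts beyond the length of the list are 0.\<close>

definition part :: "nat list \<Rightarrow> nat \<Rightarrow> nat" where
  "part a j = (if 1 \<le> j \<and> j \<le> length a then a ! (j - 1) else 0)"

text \<open>The sequence \<open>a\<close> with \<open>i\<close>-th part (\<open>i \<ge> 1\<close>) increased by 1. The padding by zeros makes
  \<open>incr_part a (length a + 1) = a @ [1]\<close>.\<close>

definition incr_part :: "nat list \<Rightarrow> nat \<Rightarrow> nat list" where
  "incr_part a i = (a @ replicate (i - length a) 0)[i - 1 := part a i + 1]"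

definition num_max_parts :: "nat list \<Rightarrow> nat" where
  "num_max_parts a = count_list a (part a 1)"

definition left_son :: "nat list \<Rightarrow> nat list" where
  "left_son a = incr_part a 1"

definition has_right_son :: "nat list \<Rightarrow> bool" where
  "has_right_son a \<longleftrightarrow>
     a \<noteq> [] \<and> part a (num_max_parts a) - part a (num_max_parts a + 1) = 1"

definition right_son :: "nat list \<Rightarrow> nat list" where
  "right_son a = incr_part a (num_max_parts a + 1)"

inductive_set T_B_nodes :: "nat list set" where
  root: "[] \<in> T_B_nodes"
| left: "a \<in> T_B_nodes \<Longrightarrow> left_son a \<in> T_B_nodes"
| right: "a \<in> T_B_nodes \<Longrightarrow> has_right_son a \<Longrightarrow> right_son a \<in> T_B_nodes"

text \<open>An edge is a triple (father, label, son).\<close>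

type_synonym edge = "nat list \<times> nat \<times> nat list"

definition left_edge :: "nat list \<Rightarrow> edge" where
  "left_edge a = (a, 1, left_son a)"

definition right_edge :: "nat list \<Rightarrow> edge" where
  "right_edge a = (a, num_max_parts a + 1, right_son a)"

definition T_B :: "(nat list, edge) pre_digraph" where
  "T_B = \<lparr> verts = T_B_nodes,
           arcs = left_edge ` T_B_nodes \<union> right_edge ` {a \<in> T_B_nodes. has_right_son a},
           tail = \<lambda>(a, l, b). a,
           head = \<lambda>(a, l, b). b \<rparr>"

definition whole_subtree :: "nat list \<Rightarrow> (nat list, edge) pre_digraph" where
  "whole_subtree a = T_B \<restriction> {b. a \<rightarrow>\<^sup>*\<^bsub>T_B\<^esub> b}"

text \<open>Adding the edge from \<open>a\<close> to its left son to a graph also adds the node \<open>a\<close>.\<close>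

definition with_left_subtree :: "nat list \<Rightarrow> (nat list, edge) pre_digraph" where
  "with_left_subtree a = pre_digraph.add_arc (whole_subtree (left_son a)) (left_edge a)"

text \<open>\<open>X_subtree k a S\<close>: \<open>S\<close> is an \<open>X\<^sub>k\<close> subtree of \<open>T_B\<close> with root \<open>a\<close>. Any single node is
  an \<open>X\<^sub>0\<close> subtree. The out-degree is the number of sons, as the sons of a node are distinct.\<close>

definition X_subtree :: "nat \<Rightarrow> nat list \<Rightarrow> (nat list, edge) pre_digraph \<Rightarrow> bool" where
  "X_subtree k a S \<longleftrightarrow> a \<in> verts T_B \<and>
     (if k = 0 then S = T_B \<restriction> {a}
      else (\<exists>i\<ge>1. (\<forall>j\<in>{1..k}. part a j = i) \<and> part a (k + 1) \<le> i - 1) \<and>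
           S = (if out_degree T_B a = 1 then whole_subtree a else with_left_subtree a))"

lemma partition_split:
  assumes "is_partition a" "a \<noteq> []"
  obtains p x r where "a = replicate p x @ r" "0 < p" "0 < x" "\<forall>y\<in>set r. y < x"
    "is_partition r" "num_max_parts a = p" "part a p = x"
    "part a (p + 1) = (if r = [] then 0 else hd r)"
proof -
  define x where "x = hd a"
  define q where "q = takeWhile (\<lambda>y. y = x) a"
  define r where "r = dropWhile (\<lambda>y. y = x) a"
  define p where "p = length q"
  have "\<forall>y\<in>set q. y = x" by (simp add: q_def) (meson set_takeWhileD)
  then have q: "q = replicate p x" by (simp add: p_def replicate_eqI)
  have a: "a = replicate p x @ r" by (simp flip: q add: q_def r_def)
  have p: "0 < p" using assms(2) by (cases a) (auto simp: p_def q_def x_def)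
  have max: "\<forall>y\<in>set a. y \<le> x"
    using assms by (cases a) (auto simp: is_partition_def x_def)
  have r: "is_partition r" and x: "0 < x"
    using assms(1) p by (auto simp: a is_partition_def sorted_wrt_append)
  have less: "\<forall>y\<in>set r. y < x"
  proof (cases r)
    case (Cons h t)
    have "h \<noteq> x"
      using hd_dropWhile[of "\<lambda>y. y = x" a] Cons by (simp flip: r_def)
    then have "h < x" using max by (auto simp: a Cons)
    then show ?thesis using r by (auto simp: is_partition_def Cons)
  qed simp
  have p1: "part a 1 = x" using p by (simp add: a part_def nth_append)
  have "count_list r x = 0" using less by (auto simp: count_list_0_iff)
  moreover have "count_list (replicate p x) x = p" by (induction p) auto
  ultimately have "num_max_parts a = p"
    unfolding num_max_parts_def p1 by (subst a) simp
  moreover have "part a p = x" using p by (simp add: a part_def nth_append)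
  moreover have "part a (p + 1) = (if r = [] then 0 else hd r)"
    by (cases r) (simp_all add: a part_def nth_append)
  ultimately show ?thesis using that[OF a p x less r] by simp
qed

lemma T_B_nodes_partition: "a \<in> T_B_nodes \<Longrightarrow> is_partition a"
proof (induction rule: T_B_nodes.induct)
  case root
  show ?case by (simp add: is_partition_def)
next
  case (left a)
  then show ?case
    by (cases a rule: list.exhaust) (auto simp: is_partition_def left_son_def incr_part_def part_def le_SucI)
next
  case (right a)
  then have ne: "a \<noteq> []" by (simp add: has_right_son_def)
  obtain p x r where *: "a = replicate p x @ r" "0 < p" "0 < x" "\<forall>y\<in>set r. y < x"
    "is_partition r" "num_max_parts a = p" "part a p = x"
    "part a (p + 1) = (if r = [] then 0 else hd r)"
    using partition_split[OF right.IH ne] by metis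
  have d: "x - (if r = [] then 0 else hd r) = 1"
    using right.hyps(2) * by (simp add: has_right_son_def)
  have rep: "sorted_wrt (\<ge>) (replicate p x)"
    by (induction p) auto
  show ?case
  proof (cases r rule: list.exhaust)
    case Nil
    then have x: "x = 1" using d by simp
    have "part a (p + 1) = 0" "length a = p" using * Nil by auto
    then have "right_son a = (a @ [0])[p := 1]"
      by (simp add: right_son_def incr_part_def *(6))
    also have "\<dots> = replicate p x @ [1]"
      using *(1) Nil by (simp add: list_update_append)
    finally show ?thesis
      using rep x by (simp add: is_partition_def sorted_wrt_append)
  next
    case (Cons h t)
    have h: "Suc h = x" using d Cons by simp
    have "part a (p + 1) = h" "p + 1 \<le> length a" using * Cons by auto
    then have "right_son a = a[p := x]"
      using h by (simp add: right_son_def incr_part_def *(6))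
    also have "\<dots> = replicate p x @ (x # t)"
      using *(1) Cons by (simp add: list_update_append)
    finally show ?thesis
      using rep *(3,5) Cons h
      by (auto simp: is_partition_def sorted_wrt_append intro: le_SucI)
  qed
qed

lemma wf_digraph_T_B: "wf_digraph T_B"
  by unfold_locales
    (auto simp: T_B_def left_edge_def right_edge_def intro: T_B_nodes.intros)

end

theory Submission
  imports Defs
begin

text \<open>If the first \<open>k\<close> parts of \<open>r\<close> equal \<open>x\<close>, the \<open>i\<close>-th node of the chain is \<open>r\<close> with its first
  \<open>i - 1\<close> parts raised to \<open>x + 1\<close>. It has a right son for \<open>2 \<le> i \<le> k\<close>, as its next part is \<open>x\<close>, but
  not for \<open>i = k + 1\<close>, where the next part is at most \<open>x - 1\<close>. Every node of the tree has at most
  one father, so the subtrees of its two sons are disjoint; peeling off the left subtrees along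
  the chain therefore partitions the \<open>X\<^sub>k\<close> subtree.\<close>

section \<open>Partitions read through their parts\<close>

lemma part_incr_part:
  assumes "1 \<le> i"
  shows "part (incr_part a i) j = part a j + (if j = i then 1 else 0)"
  using assms by (auto simp: part_def incr_part_def nth_append nth_list_update)

lemma sum_list_incr_part:
  assumes "1 \<le> i"
  shows "sum_list (incr_part a i) = sum_list a + 1"
proof -
  have "i - 1 < length (a @ replicate (i - length a) 0)"
    using assms by simp
  moreover have "(a @ replicate (i - length a) 0) ! (i - 1) = part a i"
    using assms by (auto simp: part_def nth_append)
  ultimately show ?thesis
    by (simp add: incr_part_def sum_list_update sum_list_replicate
        del: length_append)
qed

lemma partition_part_pos_iff:
  assumes "is_partition a"
  shows "0 < part a j \<longleftrightarrow> 1 \<le> j \<and> j \<le> length a"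
  using assms by (auto simp: part_def is_partition_def)

text \<open>Entries of a partition are positive, so padding with zeros loses nothing: the length is
  the last index with a nonzero part.\<close>

lemma partition_eqI:
  assumes "is_partition a" "is_partition b" "\<And>j. part a j = part b j"
  shows "a = b"
proof -
  have le: "j \<le> length a \<longleftrightarrow> j \<le> length b" if "1 \<le> j" for j
    using partition_part_pos_iff[OF assms(1), of j] partition_part_pos_iff[OF assms(2), of j]
      assms(3)[of j] that by simp
  have len: "length a = length b"
    using le[of "length a"] le[of "length b"] by (cases "length a"; cases "length b") auto
  show ?thesis
  proof (rule nth_equalityI[OF len])
    fix n assume "n < length a"
    then show "a ! n = b ! n"
      using assms(3)[of "n + 1"] len by (simp add: part_def)
  qed
qed

lemma partition_part_antimono:
  assumes "is_partition a" "1 \<le> i" "i \<le> j"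
  shows "part a j \<le> part a i"
proof (cases "i = j \<or> length a < j")
  case False
  then have "i - 1 < j - 1" "j - 1 < length a" using assms by auto
  then have "a ! (j - 1) \<le> a ! (i - 1)"
    using assms(1) by (auto simp: is_partition_def sorted_wrt_iff_nth_less)
  then show ?thesis using assms False by (simp add: part_def)
qed (use assms in \<open>auto simp: part_def\<close>)

text \<open>A partition starts with the block of its maximal parts, so the count
  \<open>num_max_parts a\<close> is also the position where that block ends.\<close>

lemma part_eq_max_iff:
  assumes "is_partition a" "a \<noteq> []" "1 \<le> j"
  shows "part a j = part a 1 \<longleftrightarrow> j \<le> num_max_parts a"
proof -
  obtain p x r where a: "a = replicate p x @ r" "0 < p" "0 < x" "\<forall>y\<in>set r. y < x"
    "is_partition r" "num_max_parts a = p" "part a p = x"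
    "part a (p + 1) = (if r = [] then 0 else hd r)"
    using partition_split[OF assms(1,2)] by metis
  have 1: "part a 1 = x" using a(2) by (simp add: a(1) part_def nth_append)
  have "part a (p + 1) < x" using a(3,4,8) by (cases r) auto
  then have "part a j < x" if "p < j"
    using partition_part_antimono[OF assms(1), of "p + 1" j] that by simp
  moreover have "part a j = x" if "j \<le> p"
  proof -
    have "j - 1 < p" using that assms(3) by simp
    then show ?thesis using assms(3) that by (simp add: a(1) part_def nth_append)
  qed
  ultimately show ?thesis
    unfolding 1 a(6) by (metis less_irrefl not_le)
qed

lemma num_max_parts_pos:
  assumes "is_partition a" "a \<noteq> []"
  shows "1 \<le> num_max_parts a"
  using part_eq_max_iff[OF assms, of 1] by simp

lemma num_max_parts_eqI:
  assumes "is_partition a" "1 \<le> p" "part a p = part a 1" "part a (p + 1) < part a 1"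
  shows "num_max_parts a = p"
proof -
  have ne: "a \<noteq> []" using assms(4) by (auto simp: part_def)
  show ?thesis
    using part_eq_max_iff[OF assms(1) ne, of p] part_eq_max_iff[OF assms(1) ne, of "p + 1"]
      assms by simp
qed

section \<open>Edges of the tree and uniqueness of fathers\<close>

lemma T_B_simps [simp]:
  "verts T_B = T_B_nodes"
  "arcs T_B = left_edge ` T_B_nodes \<union> right_edge ` {a \<in> T_B_nodes. has_right_son a}"
  "tail T_B e = fst e" "head T_B e = snd (snd e)"
  by (auto simp: T_B_def split: prod.splits)

lemma num_max_parts_left_son:
  assumes "a \<in> T_B_nodes"
  shows "num_max_parts (left_son a) = 1"
proof (rule num_max_parts_eqI)
  show "is_partition (left_son a)"
    using assms by (intro T_B_nodes_partition T_B_nodes.left)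
  show "part (left_son a) (1 + 1) < part (left_son a) 1"
    using partition_part_antimono[OF T_B_nodes_partition[OF assms], of 1 2]
    by (simp add: left_son_def part_incr_part numeral_2_eq_2)
qed auto

text \<open>A right son exists only if the part just after the maximal block is smaller by exactly
  1; raising it extends the block by one position.\<close>

lemma num_max_parts_right_son:
  assumes "a \<in> T_B_nodes" "has_right_son a"
  shows "num_max_parts (right_son a) = num_max_parts a + 1"
proof (rule num_max_parts_eqI)
  let ?p = "num_max_parts a"
  have a: "is_partition a" "a \<noteq> []"
    using assms by (auto simp: has_right_son_def T_B_nodes_partition)
  have p: "1 \<le> ?p" by (rule num_max_parts_pos[OF a])
  have eq: "part a ?p = part a 1" using part_eq_max_iff[OF a p] by simp
  have diff: "part a 1 = part a (?p + 1) + 1"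
    using assms(2) eq unfolding has_right_son_def by linarith
  show "is_partition (right_son a)"
    using assms by (intro T_B_nodes_partition T_B_nodes.right)
  show "part (right_son a) (?p + 1) = part (right_son a) 1"
    using diff p by (simp add: right_son_def part_incr_part)
  show "part (right_son a) (?p + 1 + 1) < part (right_son a) 1"
    using diff p partition_part_antimono[OF a(1), of "?p + 1" "?p + 2"]
    by (simp add: right_son_def part_incr_part)
qed simp

text \<open>The label of an edge is the number of maximal parts of the son, so the son determines both
  the label and the father.\<close>

lemma arc_T_B_son:
  assumes "e \<in> arcs T_B"
  shows "fst (snd e) = num_max_parts (snd (snd e))"
    and "snd (snd e) = incr_part (fst e) (fst (snd e))" and "1 \<le> fst (snd e)"
    and "fst e \<in> T_B_nodes" and "snd (snd e) \<in> T_B_nodes"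
  using assms num_max_parts_left_son num_max_parts_right_son
  by (auto simp: left_edge_def right_edge_def left_son_def right_son_def
      simp flip: One_nat_def intro: T_B_nodes.intros[unfolded left_son_def right_son_def])

lemma unique_father:
  assumes "e \<in> arcs T_B" "f \<in> arcs T_B" "snd (snd e) = snd (snd f)"
  shows "e = f"
proof -
  have label: "fst (snd e) = fst (snd f)"
    using assms arc_T_B_son(1) by metis
  \<comment> \<open>Lowering the son by 1 at the common label gives back the father.\<close>
  have "part (fst e) j = part (fst f) j" for j
    using part_incr_part[OF arc_T_B_son(3)[OF assms(1)], of "fst e" j]
      part_incr_part[OF arc_T_B_son(3)[OF assms(2)], of "fst f" j]
      arc_T_B_son(2)[OF assms(1)] arc_T_B_son(2)[OF assms(2)] assms(3) label
    by (metis add_right_cancel)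
  then have "fst e = fst f"
    using assms by (intro partition_eqI T_B_nodes_partition arc_T_B_son(4))
  then show ?thesis using label assms(3) by (simp add: prod_eq_iff)
qed

section \<open>Descendants and their disjointness\<close>

definition descendants :: "nat list \<Rightarrow> nat list set" where
  "descendants a = {b. a \<rightarrow>\<^sup>*\<^bsub>T_B\<^esub> b}"

lemma dominates_T_B_iff:
  "a \<rightarrow>\<^bsub>T_B\<^esub> b \<longleftrightarrow>
    a \<in> T_B_nodes \<and> (b = left_son a \<or> has_right_son a \<and> b = right_son a)"
  by (force simp: arcs_ends_def arc_to_ends_def left_edge_def right_edge_def)

text \<open>The sum of the parts is the depth of a node; its growth along edges is what excludes
  loops and cycles.\<close>

lemma sum_list_son:
  assumes "a \<rightarrow>\<^bsub>T_B\<^esub> b"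
  shows "sum_list b = sum_list a + 1"
  using assms by (auto simp: dominates_T_B_iff left_son_def right_son_def sum_list_incr_part)

lemma sum_list_descendants:
  assumes "b \<in> descendants a"
  shows "sum_list a \<le> sum_list b"
proof -
  interpret wf_digraph T_B by (rule wf_digraph_T_B)
  have "a \<rightarrow>\<^sup>*\<^bsub>T_B\<^esub> b" using assms by (simp add: descendants_def)
  then show ?thesis by (induction rule: reachable_induct) (auto dest: sum_list_son)
qed

lemma not_in_descendants_son:
  assumes "a \<rightarrow>\<^bsub>T_B\<^esub> b"
  shows "a \<notin> descendants b"
  using sum_list_descendants[of a b] sum_list_son[OF assms] by auto

lemma descendants_unfold:
  assumes "a \<in> T_B_nodes"
  shows "descendants a = insert a (descendants (left_son a) \<union>
    (if has_right_son a then descendants (right_son a) else {}))"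
proof -
  interpret wf_digraph T_B by (rule wf_digraph_T_B)
  have "b \<in> descendants a \<longleftrightarrow> b = a \<or> (\<exists>c. a \<rightarrow>\<^bsub>T_B\<^esub> c \<and> b \<in> descendants c)" for b
    using assms unfolding descendants_def mem_Collect_eq
    by (metis T_B_simps(1) adj_reachable_trans converse_reachable_cases reachable_refl)
  then show ?thesis
    using assms by (auto simp: dominates_T_B_iff split: if_splits)
qed

lemma descendants_subset: "descendants a \<subseteq> T_B_nodes"
proof -
  interpret wf_digraph T_B by (rule wf_digraph_T_B)
  show ?thesis by (auto simp: descendants_def dest: reachable_in_verts(2))
qed

lemma son_in_descendants:
  assumes "b \<in> descendants a" "b \<rightarrow>\<^bsub>T_B\<^esub> c"
  shows "c \<in> descendants a"
proof -
  interpret wf_digraph T_B by (rule wf_digraph_T_B)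
  show ?thesis using assms by (auto simp: descendants_def intro: reachable_adj_trans)
qed

text \<open>A path from \<open>b\<close> to \<open>c\<close> with \<open>c \<noteq> b\<close> has a
  last edge, and the tail of that edge is the only father of \<open>c\<close>.\<close>

lemma father_in_descendants:
  assumes "a \<rightarrow>\<^bsub>T_B\<^esub> c" "c \<in> descendants b" "c \<noteq> b"
  shows "a \<in> descendants b"
proof -
  interpret wf_digraph T_B by (rule wf_digraph_T_B)
  have "b \<rightarrow>\<^sup>*\<^bsub>T_B\<^esub> c" using assms(2) by (simp add: descendants_def)
  then show ?thesis using assms(1,3)
  proof (induction rule: reachable_induct)
    case (step y z)
    obtain e f where "e \<in> arcs T_B" "fst e = y" "snd (snd e) = z"
      "f \<in> arcs T_B" "fst f = a" "snd (snd f) = z"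
      using step.hyps(2) step.prems(1) by (auto simp del: T_B_simps(2) simp: arcs_ends_def arc_to_ends_def)
    then have "y = a" using unique_father by metis
    then show ?case using step.hyps(1) by (simp add: descendants_def)
  qed simp
qed

text \<open>The ancestors of a common descendant form a chain, by uniqueness of fathers.\<close>

lemma descendants_comparable:
  assumes "c \<in> descendants a" "c \<in> descendants b"
  shows "a \<in> descendants b \<or> b \<in> descendants a"
proof -
  interpret wf_digraph T_B by (rule wf_digraph_T_B)
  have "a \<rightarrow>\<^sup>*\<^bsub>T_B\<^esub> c" using assms(1) by (simp add: descendants_def)
  then show ?thesis using assms(2)
  proof (induction rule: reachable_induct)
    case (step y z)
    show ?case
    proof (cases "z = b")
      case True
      then show ?thesis using step.hyps by (auto simp: descendants_def intro: reachable_adj_trans)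
    next
      case False
      then show ?thesis using step father_in_descendants by blast
    qed
  qed simp
qed

text \<open>A common descendant would make one son a descendant of the other. As the sons differ,
  their father \<open>a\<close> would then be a descendant of its own son, against the growth of the
  sum.\<close>

lemma descendants_sons_disjoint:
  assumes "a \<in> T_B_nodes" "has_right_son a"
  shows "descendants (left_son a) \<inter> descendants (right_son a) = {}"
proof (rule ccontr)
  have l: "a \<rightarrow>\<^bsub>T_B\<^esub> left_son a" and r: "a \<rightarrow>\<^bsub>T_B\<^esub> right_son a"
    using assms by (auto simp: dominates_T_B_iff)
  have "1 \<le> num_max_parts a"
    using assms by (intro num_max_parts_pos T_B_nodes_partition) (auto simp: has_right_son_def)
  \<comment> \<open>The left son has one maximal part, the right son at least two.\<close>
  then have ne: "left_son a \<noteq> right_son a"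
    using num_max_parts_left_son[OF assms(1)] num_max_parts_right_son[OF assms] by auto
  assume "descendants (left_son a) \<inter> descendants (right_son a) \<noteq> {}"
  then have "left_son a \<in> descendants (right_son a) \<or> right_son a \<in> descendants (left_son a)"
    using descendants_comparable by blast
  then show False
    using father_in_descendants[OF l _ ne] father_in_descendants[OF r _ ne[symmetric]]
      not_in_descendants_son[OF l] not_in_descendants_son[OF r] by blast
qed

section \<open>Vertices and arcs of whole, left and X subtrees\<close>

lemma verts_whole_subtree: "verts (whole_subtree a) = descendants a"
  by (simp add: whole_subtree_def descendants_def)

lemma arcs_whole_subtree:
  "arcs (whole_subtree a) = left_edge ` descendants a \<union> right_edge ` {b \<in> descendants a. has_right_son b}"
  (is "?L = ?R")
proof
  show "?L \<subseteq> ?R"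
    by (auto simp: whole_subtree_def left_edge_def right_edge_def descendants_def[symmetric])
  show "?R \<subseteq> ?L"
    using descendants_subset[of a] son_in_descendants[of _ a]
    by (auto simp: whole_subtree_def left_edge_def right_edge_def dominates_T_B_iff
        descendants_def[symmetric])
qed

lemma verts_with_left_subtree:
  assumes "a \<in> T_B_nodes"
  shows "verts (with_left_subtree a) = insert a (descendants (left_son a))"
proof -
  interpret wf_digraph T_B by (rule wf_digraph_T_B)
  \<comment> \<open>\<open>add_arc\<close> inserts both endpoints of the arc; the head is already a
    vertex, so only \<open>a\<close> is new.\<close>
  have "left_son a \<in> descendants (left_son a)"
    using assms by (simp add: descendants_def T_B_nodes.left)
  then show ?thesis
    by (auto simp: with_left_subtree_def pre_digraph.verts_add_arc_conv
        verts_whole_subtree whole_subtree_def left_edge_def descendants_def[symmetric])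
qed

lemma arcs_with_left_subtree:
  "arcs (with_left_subtree a) = insert (left_edge a) (arcs (whole_subtree (left_son a)))"
  by (simp add: with_left_subtree_def pre_digraph.arcs_add_arc)

lemma out_degree_T_B:
  assumes "a \<in> T_B_nodes"
  shows "out_degree T_B a = 1 \<longleftrightarrow> \<not> has_right_son a"
proof -
  have "out_arcs T_B a = {left_edge a} \<union> (if has_right_son a then {right_edge a} else {})"
    using assms by (auto simp: out_arcs_def left_edge_def right_edge_def)
  \<comment> \<open>The labels differ: 1 against at least 2. Hence two sons really count as
    out-degree 2.\<close>
  moreover have "left_edge a \<noteq> right_edge a" if "has_right_son a"
    using num_max_parts_pos[OF T_B_nodes_partition[OF assms]] that
    by (auto simp: left_edge_def right_edge_def has_right_son_def)
  ultimately show ?thesis by (auto simp: out_degree_def)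
qed

text \<open>The graph prescribed by \<open>X_subtree\<close>, freed from the condition on the parts
  of the root. It depends on \<open>k\<close> only through whether \<open>k = 0\<close>.\<close>

definition X_tree :: "nat \<Rightarrow> nat list \<Rightarrow> (nat list, edge) pre_digraph" where
  "X_tree k a = (if k = 0 then T_B \<restriction> {a}
     else if out_degree T_B a = 1 then whole_subtree a else with_left_subtree a)"

text \<open>Without a right son, the whole subtree is already the root with its left subtree, so
  both cases of the definition give the same vertices and arcs.\<close>

lemma
  assumes "a \<in> T_B_nodes" "k \<noteq> 0"
  shows verts_X_tree: "verts (X_tree k a) = insert a (descendants (left_son a))"
    and arcs_X_tree:
      "arcs (X_tree k a) = insert (left_edge a) (arcs (whole_subtree (left_son a)))"
proof -
  have D: "descendants a = insert a (descendants (left_son a))" if "\<not> has_right_son a"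
    using that by (simp add: descendants_unfold[OF assms(1)])
  have "arcs (whole_subtree a) = insert (left_edge a) (arcs (whole_subtree (left_son a)))"
    if "\<not> has_right_son a"
    using that unfolding arcs_whole_subtree D[OF that] by auto
  then show "verts (X_tree k a) = insert a (descendants (left_son a))"
    "arcs (X_tree k a) = insert (left_edge a) (arcs (whole_subtree (left_son a)))"
    using assms(2) D unfolding X_tree_def out_degree_T_B[OF assms(1)]
    by (simp_all add: verts_whole_subtree verts_with_left_subtree[OF assms(1)]
        arcs_with_left_subtree)
qed

lemma verts_X_tree_0: "verts (X_tree 0 a) = {a}"
  by (simp add: X_tree_def)

lemma arcs_X_tree_0:
  "arcs (X_tree 0 a) = {}"
proof -
  \<comment> \<open>An arc induced on one node would be a loop.\<close>
  have "b \<noteq> a" if "a \<rightarrow>\<^bsub>T_B\<^esub> b" for b using sum_list_son[OF that] by auto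
  then show ?thesis
    by (auto simp: X_tree_def left_edge_def right_edge_def dominates_T_B_iff)
qed

section \<open>The chain of roots\<close>

text \<open>Indexed from 1 as in the statement; the value at 0 is junk.\<close>

fun X_chain :: "nat list \<Rightarrow> nat \<Rightarrow> nat list" where
  "X_chain r 0 = r"
| "X_chain r (Suc i) = (if i = 0 then r else incr_part (X_chain r i) i)"

lemma part_X_chain:
  "1 \<le> i \<Longrightarrow> part (X_chain r i) j = part r j + (if 1 \<le> j \<and> j < i then 1 else 0)"
proof (induction i)
  case (Suc i)
  then show ?case by (cases "i = 0") (auto simp: part_incr_part)
qed simp

lemma X_chain_node_props:
  assumes "\<forall>j\<in>{1..k}. part r j = x" "part r (k + 1) \<le> x - 1" "1 \<le> x"
    and "2 \<le> i" "i \<le> k + 1" and node: "X_chain r i \<in> T_B_nodes"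
  shows "num_max_parts (X_chain r i) = i - 1"
    and "has_right_son (X_chain r i) \<longleftrightarrow> i \<le> k"
proof -
  let ?c = "X_chain r i"
  have max: "part ?c j = x + 1" if "j \<in> {1..i - 1}" for j
    using assms(1,4,5) that by (auto simp: part_X_chain)
  have i: "part ?c i = (if i \<le> k then x else part r (k + 1))"
    using assms(1,4,5) by (auto simp: part_X_chain le_Suc_eq)
  have "part ?c i < x + 1" using i assms(2) by auto
  then show p: "num_max_parts ?c = i - 1"
    using assms(4) max[of 1] max[of "i - 1"] T_B_nodes_partition[OF node]
    by (intro num_max_parts_eqI) auto
  have "part ?c 1 = x + 1" using max assms(4) by simp
  then have "?c \<noteq> []" by (auto simp: part_def)
  then have "has_right_son ?c \<longleftrightarrow> part ?c (i - 1) - part ?c i = 1"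
    using assms(4) by (simp add: has_right_son_def p)
  \<comment> \<open>For \<open>i \<le> k\<close> the gap is \<open>(x + 1) - x\<close>. For
    \<open>i = k + 1\<close> it is at least 2, since \<open>1 \<le> x\<close> keeps the truncated
    \<open>x - 1\<close> strictly below \<open>x\<close>.\<close>
  also have "\<dots> \<longleftrightarrow> i \<le> k" using i max[of "i - 1"] assms(2-4) by auto
  finally show "has_right_son ?c \<longleftrightarrow> i \<le> k" .
qed

lemma X_chain_2: "X_chain r 2 = left_son r"
  by (simp add: numeral_2_eq_2 left_son_def)

lemma X_chain_right_son:
  assumes "\<forall>j\<in>{1..k}. part r j = x" "part r (k + 1) \<le> x - 1" "1 \<le> x"
    and "2 \<le> i" "i \<le> k" and node: "X_chain r i \<in> T_B_nodes"
  shows "X_chain r (i + 1) = right_son (X_chain r i)"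
  using X_chain_node_props(1)[of k r x i] assms by (simp add: right_son_def)

lemma X_chain_in_T_B:
  assumes "r \<in> T_B_nodes" "\<forall>j\<in>{1..k}. part r j = x" "part r (k + 1) \<le> x - 1" "1 \<le> x"
    and "1 \<le> i" "i \<le> k + 1"
  shows "X_chain r i \<in> T_B_nodes"
  using assms(5,6)
proof (induction i)
  case (Suc i)
  \<comment> \<open>Index 1 is the root itself, the step from 1 to 2 is a left edge, and all later
    steps are right edges.\<close>
  consider "i = 0" | "i = 1" | "2 \<le> i" by linarith
  then show ?case
  proof cases
    case 1
    then show ?thesis using assms(1) by simp
  next
    case 2
    then show ?thesis using assms(1) X_chain_2[of r] by (simp add: numeral_2_eq_2 T_B_nodes.left)
  next
    case 3
    then have "X_chain r i \<in> T_B_nodes" "i \<le> k" using Suc by auto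
    then show ?thesis
      using X_chain_right_son[OF assms(2-4) 3] X_chain_node_props(2)[OF assms(2-4) 3]
      by (simp add: T_B_nodes.right del: X_chain.simps)
  qed
qed simp

section \<open>Peeling left subtrees off a right chain\<close>

text \<open>One peeling step: what remains outside the X subtree at \<open>a\<close> is the right
  subtree, if any, and the edge leading to it.\<close>

lemma whole_subtree_eq_X_tree:
  assumes "a \<in> T_B_nodes" "k \<noteq> 0"
  shows "descendants a = verts (X_tree k a) \<union>
      (if has_right_son a then descendants (right_son a) else {})"
    and "arcs (whole_subtree a) = arcs (X_tree k a) \<union>
      (if has_right_son a then insert (right_edge a) (arcs (whole_subtree (right_son a))) else {})"
proof -
  show "descendants a = verts (X_tree k a) \<union>
      (if has_right_son a then descendants (right_son a) else {})"
    using descendants_unfold[OF assms(1)] by (simp add: verts_X_tree[OF assms])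
  show "arcs (whole_subtree a) = arcs (X_tree k a) \<union>
      (if has_right_son a then insert (right_edge a) (arcs (whole_subtree (right_son a))) else {})"
    unfolding arcs_X_tree[OF assms] arcs_whole_subtree descendants_unfold[OF assms(1)] by auto
qed

lemma X_tree_disjoint_right_subtree:
  assumes "a \<in> T_B_nodes" "k \<noteq> 0" "has_right_son a"
  shows "verts (X_tree k a) \<inter> descendants (right_son a) = {}"
  using descendants_sons_disjoint[OF assms(1,3)] not_in_descendants_son[of a "right_son a"] assms
  by (simp add: verts_X_tree dominates_T_B_iff)

text \<open>\<open>right_edge b\<close> is a triple even if \<open>b\<close> has no right son. Its
  label is at least 2, so it is no left edge and can occur only as the right edge of its own tail
  \<open>b\<close>.\<close>

lemma right_edge_in_whole_subtreeD:
  assumes "right_edge b \<in> arcs (whole_subtree a)" "is_partition b" "b \<noteq> []"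
  shows "b \<in> descendants a" "has_right_son b"
  using assms(1) num_max_parts_pos[OF assms(2,3)]
  by (auto simp: arcs_whole_subtree left_edge_def right_edge_def)

text \<open>Downward induction on the start \<open>m\<close> of the chain, one peeling step at a
  time. As \<open>2 \<le> m\<close>, no index \<open>i - 1\<close> is 0, so single-node trees do not
  occur here.\<close>

lemma right_chain_decomposition:
  fixes k :: nat and c :: "nat \<Rightarrow> nat list"
  assumes c: "\<And>i. m \<le> i \<Longrightarrow> i \<le> k + 1 \<Longrightarrow> c i \<in> T_B_nodes"
    "\<And>i. m \<le> i \<Longrightarrow> i \<le> k + 1 \<Longrightarrow> has_right_son (c i) \<longleftrightarrow> i \<le> k"
    "\<And>i. m \<le> i \<Longrightarrow> i \<le> k \<Longrightarrow> c (i + 1) = right_son (c i)"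
    and m: "2 \<le> m" "m \<le> k + 1"
  defines "T \<equiv> \<lambda>i. X_tree (i - 1) (c i)"
  shows "descendants (c m) = (\<Union>i\<in>{m..k + 1}. verts (T i)) \<and>
    arcs (whole_subtree (c m)) =
      (\<Union>i\<in>{m..k + 1}. arcs (T i)) \<union> right_edge ` c ` {m..k} \<and>
    disjoint_family_on (\<lambda>i. verts (T i)) {m..k + 1}"
  using m(2,1) c
proof (induction m rule: inc_induct)
  case base
  \<comment> \<open>The last node has no right son, so its whole subtree is a single piece.\<close>
  then show ?case
    using whole_subtree_eq_X_tree[of "c (k + 1)" k]
    by (simp add: T_def disjoint_family_on_def)
next
  case (step n)
  have n: "c n \<in> T_B_nodes" "n - 1 \<noteq> 0" "has_right_son (c n)" "c (Suc n) = right_son (c n)"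
    using step.hyps step.prems by auto
  have IH: "descendants (c (Suc n)) = (\<Union>i\<in>{Suc n..k + 1}. verts (T i))"
    "arcs (whole_subtree (c (Suc n))) =
      (\<Union>i\<in>{Suc n..k + 1}. arcs (T i)) \<union> right_edge ` c ` {Suc n..k}"
    "disjoint_family_on (\<lambda>i. verts (T i)) {Suc n..k + 1}"
    using step by simp_all
  have I: "{n..k + 1} = insert n {Suc n..k + 1}" "{n..k} = insert n {Suc n..k}"
    using step.hyps by auto
  \<comment> \<open>By the induction hypothesis all later pieces lie below the right son.\<close>
  have "verts (T n) \<inter> (\<Union>i\<in>{Suc n..k + 1}. verts (T i)) = {}"
    using X_tree_disjoint_right_subtree[OF n(1-3)] n(4) IH(1) by (simp add: T_def)
  then have "disjoint_family_on (\<lambda>i. verts (T i)) {n..k + 1}"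
    unfolding I using IH(3) by (subst disjoint_family_on_insert) auto
  moreover have "descendants (c n) = (\<Union>i\<in>{n..k + 1}. verts (T i))"
    using whole_subtree_eq_X_tree(1)[OF n(1,2)] n(3,4) IH(1)
    unfolding I by (simp add: T_def)
  moreover have "arcs (whole_subtree (c n)) =
      (\<Union>i\<in>{n..k + 1}. arcs (T i)) \<union> right_edge ` c ` {n..k}"
    using whole_subtree_eq_X_tree(2)[OF n(1,2)] n(3,4) IH(2)
    unfolding I by (auto simp: T_def)
  ultimately show ?case by blast
qed

section \<open>Decomposition of an X subtree\<close>

theorem proposition6:
  fixes k :: nat and r :: "nat list" and S :: "(nat list, edge) pre_digraph"
  assumes "1 \<le> k" and "X_subtree k r S"
  shows "\<exists>(c :: nat \<Rightarrow> nat list) (T :: nat \<Rightarrow> (nat list, edge) pre_digraph).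
    c 1 = r \<and> c 2 = left_son r \<and>
    (\<forall>i\<in>{2..k}. has_right_son (c i) \<and> c (i + 1) = right_son (c i)) \<and>
    right_edge r \<notin> arcs S \<and> right_edge (c (k + 1)) \<notin> arcs S \<and>
    (\<forall>i\<in>{1..k}. (c i, i, c (i + 1)) \<in> arcs S) \<and>
    (\<forall>i\<in>{1..k + 1}. X_subtree (i - 1) (c i) (T i)) \<and>
    disjoint_family_on (\<lambda>i. verts (T i)) {1..k + 1} \<and>
    verts S = (\<Union>i\<in>{1..k + 1}. verts (T i)) \<and>
    arcs S = (\<Union>i\<in>{1..k + 1}. arcs (T i)) \<union> {(c i, i, c (i + 1)) | i. i \<in> {1..k}}"
proof -
  obtain x where x: "1 \<le> x" "\<forall>j\<in>{1..k}. part r j = x" "part r (k + 1) \<le> x - 1"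
    and r: "r \<in> T_B_nodes" and S: "S = X_tree k r"
    using assms by (auto simp: X_subtree_def X_tree_def split: if_splits)
  define c where "c = X_chain r"
  define T where "T i = X_tree (i - 1) (c i)" for i
  have c1: "c 1 = r" and c2: "c 2 = left_son r"
    by (simp_all add: c_def X_chain_2)
  have node: "c i \<in> T_B_nodes" if "1 \<le> i" "i \<le> k + 1" for i
    unfolding c_def by (rule X_chain_in_T_B[OF r x(2,3,1) that])
  have max: "num_max_parts (c i) = i - 1" and right: "has_right_son (c i) \<longleftrightarrow> i \<le> k"
    if "2 \<le> i" "i \<le> k + 1" for i
    using X_chain_node_props[OF x(2,3,1) that] node that by (simp_all add: c_def)
  have next_c: "c (i + 1) = right_son (c i)" if "2 \<le> i" "i \<le> k" for i
    using X_chain_right_son[OF x(2,3,1) that] node that unfolding c_def by simp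
  have chain_edge: "right_edge (c i) = (c i, i, c (i + 1))" if "2 \<le> i" "i \<le> k" for i
    using max[of i] next_c[of i] that by (simp add: right_edge_def)
  \<comment> \<open>The right chain starts at the left son of \<open>r\<close>; \<open>r\<close>
    itself is the single-node piece \<open>T 1\<close>, joined by the left edge.\<close>
  have decomp: "descendants (c 2) = (\<Union>i\<in>{2..k + 1}. verts (T i))"
    "arcs (whole_subtree (c 2)) =
      (\<Union>i\<in>{2..k + 1}. arcs (T i)) \<union> right_edge ` c ` {2..k}"
    "disjoint_family_on (\<lambda>i. verts (T i)) {2..k + 1}"
    using right_chain_decomposition[of 2 k c] node right next_c assms(1)
    unfolding T_def by simp_all
  have I: "{1..k + 1} = insert 1 {2..k + 1}" "{1..k} = insert 1 {2..k}"
    using assms(1) by auto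
  have T1: "verts (T 1) = {r}" "arcs (T 1) = {}"
    by (simp_all add: T_def c1 verts_X_tree_0 arcs_X_tree_0 del: One_nat_def)
  have r_notin: "r \<notin> descendants (c 2)"
    using r by (intro not_in_descendants_son) (simp add: c2 dominates_T_B_iff)
  have "disjoint_family_on (\<lambda>i. verts (T i)) {1..k + 1}"
    unfolding I using decomp(1,3) r_notin T1
    by (subst disjoint_family_on_insert) auto
  moreover have "verts S = (\<Union>i\<in>{1..k + 1}. verts (T i))"
    unfolding I S using assms(1) T1 decomp(1)
    by (simp add: verts_X_tree[OF r] c2)
  moreover have arcs_S: "arcs S = insert (left_edge r) (arcs (whole_subtree (c 2)))"
    unfolding S using assms(1) by (simp add: arcs_X_tree[OF r] c2)
  moreover have left: "left_edge r = (c 1, 1, c (1 + 1))"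
    using c1 c2 by (simp add: left_edge_def numeral_2_eq_2)
  moreover have "right_edge ` c ` {2..k} = (\<lambda>i. (c i, i, c (i + 1))) ` {2..k}"
    using chain_edge by (force simp: image_image)
  ultimately have main: "disjoint_family_on (\<lambda>i. verts (T i)) {1..k + 1}"
    "verts S = (\<Union>i\<in>{1..k + 1}. verts (T i))"
    "arcs S = (\<Union>i\<in>{1..k + 1}. arcs (T i)) \<union> {(c i, i, c (i + 1)) | i. i \<in> {1..k}}"
    unfolding I using T1 decomp(2) by auto
  have "part r 1 = x" using x(2) assms(1) by simp
  then have r_ne: "r \<noteq> []" using x(1) by (auto simp: part_def)
  have r_part: "is_partition r" by (rule T_B_nodes_partition[OF r])
  have "right_edge r \<noteq> left_edge r"
    using num_max_parts_pos[OF r_part r_ne] by (auto simp: right_edge_def left_edge_def)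
  \<comment> \<open>Apart from the left edge of \<open>r\<close>, all arcs of \<open>S\<close> start
    in the left subtree, which does not contain \<open>r\<close>.\<close>
  then have no_right_root: "right_edge r \<notin> arcs S"
    using arcs_S right_edge_in_whole_subtreeD(1)[OF _ r_part r_ne] r_notin by auto
  have last: "num_max_parts (c (k + 1)) = k" "\<not> has_right_son (c (k + 1))"
    using max[of "k + 1"] right[of "k + 1"] assms(1) by auto
  have last_part: "is_partition (c (k + 1))" using node by (intro T_B_nodes_partition) simp
  have last_ne: "c (k + 1) \<noteq> []"
    using last(1) assms(1) by (auto simp: num_max_parts_def)
  \<comment> \<open>Its label is \<open>k + 1\<close>, so it is not the left edge of
    \<open>r\<close>; inside the left subtree it would require a right son of
    \<open>c (k + 1)\<close>.\<close>
  have no_right_last: "right_edge (c (k + 1)) \<notin> arcs S"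
    using arcs_S last assms(1) right_edge_in_whole_subtreeD(2)[OF _ last_part last_ne]
    by (auto simp: right_edge_def left_edge_def)
  have X: "X_subtree (i - 1) (c i) (T i)" if "i \<in> {1..k + 1}" for i
  proof (cases "i = 1")
    case True
    then show ?thesis using r c1 by (simp add: X_subtree_def X_tree_def T_def)
  next
    case False
    \<comment> \<open>The first \<open>i - 1\<close> parts have been raised, so the common value
      required of an \<open>X\<close> root is now \<open>x + 1\<close>, and part \<open>i\<close> is
      still unraised.\<close>
    then have "\<forall>j\<in>{1..i - 1}. part (c i) j = x + 1" "part (c i) i \<le> x"
      using that x by (auto simp: c_def part_X_chain le_Suc_eq)
    then have "\<exists>y\<ge>1. (\<forall>j\<in>{1..i - 1}. part (c i) j = y) \<and> part (c i) (i - 1 + 1) \<le> y - 1"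
      using that by (intro exI[of _ "x + 1"]) simp
    then show ?thesis
      using that False node by (auto simp: X_subtree_def X_tree_def T_def)
  qed
  have edges: "\<forall>i\<in>{1..k}. (c i, i, c (i + 1)) \<in> arcs S"
    unfolding main(3) by blast
  have right_sons: "\<forall>i\<in>{2..k}. has_right_son (c i) \<and> c (i + 1) = right_son (c i)"
    using right next_c by auto
  show ?thesis
    by (rule exI[of _ c], rule exI[of _ T], intro conjI ballI)
      (fact c1 c2 no_right_root no_right_last main X edges[rule_format]
        right_sons[rule_format, THEN conjunct1] right_sons[rule_format, THEN conjunct2])+
qed

end
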